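(* Let $\Gamma$ be a finite simple graph with more than one vertex which has exactly one universal vertex. Then the generalised CAP bound for $\Gamma$ is strictly smaller than the Haemers bound for $\Gamma$.
   Context: A universal vertex is a vertex adjacent to every other vertex. For a finite simple graph $G$ on $v$ vertices, and a positive integer $s$, let $$\mathrm{CA}_G(x,s,k,\lambda):=x(x+1)(v-s)-2xs(k-s+1)+s(s-1)(\lambda-s+2).$$ The edge-degree of an edge is the number of common neighbours of its two endpoints. Let $G$ have at least one edge, let $\delta,\Delta$ be its minimum and maximum vertex degrees, and $\lambda_{\min},\lambda_{\max}$ the minimum and maximum edge-degrees of its edges. For every clique of $G$ with at least two vertices, the average vertex degree in $G$ over the clique lies in $[\delta,\Delta]$ and the average edge-degree in $G$ over pairs of vertices in the clique lies in $[\lambda_{\min},\lambda_{\max}]$. If for every real pair $(k,\lambda)\in[\delta,\Delta]\times[\lambda_{\min},\lambda_{\max}]$ there is an integer $x$ with $\mathrm{CA}_G(x,s,k,\lambda)<0$, then $G$ has no $s$-clique. The generalised CAP bound for $G$ is the least value of $s-1$ over all positive integers $s$ with this property. The Haemers bound for a non-complete graph $G$ on $v$ vertices is the real number $$\frac{-v\gamma_1'\gamma_v'}{(v-\Delta-1)^2-\gamma_1'\gamma_v'},$$ where $\gamma_1'$ and $\gamma_v'$ are the maximum and minimum eigenvalues of the adjacency matrix of the complement $\overline{G}$, and $\Delta$ is the maximum degree of $G$. *)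

theory Defs
  imports "Graph_Theory.Pair_Digraph" "Jordan_Normal_Form.Char_Poly"
begin

text \<open>
  A finite simple graph is a \<^locale>\<open>pair_graph\<close>: a finite loopless symmetric digraph without
  parallel arcs, in which an edge joining \<open>u\<close> and \<open>w\<close> is the pair of arcs \<open>(u, w)\<close>, \<open>(w, u)\<close>.
  The degree of a vertex is therefore its out-degree, and quantities that are symmetric in the
  endpoints of an edge may be minimised and maximised over arcs.
\<close>

definition universal_vertex :: "'a pair_pre_digraph \<Rightarrow> 'a \<Rightarrow> bool" where
  "universal_vertex G u \<longleftrightarrow> u \<in> pverts G \<and> (\<forall>w \<in> pverts G. w \<noteq> u \<longrightarrow> (u, w) \<in> parcs G)"

definition min_degree :: "'a pair_pre_digraph \<Rightarrow> nat" where
  "min_degree G = Min (out_degree (with_proj G) ` pverts G)"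

definition max_degree :: "'a pair_pre_digraph \<Rightarrow> nat" where
  "max_degree G = Max (out_degree (with_proj G) ` pverts G)"

definition edge_degree :: "'a pair_pre_digraph \<Rightarrow> 'a \<times> 'a \<Rightarrow> nat" where
  "edge_degree G e = card {w \<in> pverts G. (fst e, w) \<in> parcs G \<and> (snd e, w) \<in> parcs G}"

definition min_edge_degree :: "'a pair_pre_digraph \<Rightarrow> nat" where
  "min_edge_degree G = Min (edge_degree G ` parcs G)"

definition max_edge_degree :: "'a pair_pre_digraph \<Rightarrow> nat" where
  "max_edge_degree G = Max (edge_degree G ` parcs G)"

definition clique_adjacency ::
    "'a pair_pre_digraph \<Rightarrow> int \<Rightarrow> nat \<Rightarrow> real \<Rightarrow> real \<Rightarrow> real" where
  "clique_adjacency G x s k l =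
     real_of_int x * (real_of_int x + 1) * (real (card (pverts G)) - real s)
     - 2 * real_of_int x * real s * (k - real s + 1)
     + real s * (real s - 1) * (l - real s + 2)"

definition CAP_excludes :: "'a pair_pre_digraph \<Rightarrow> nat \<Rightarrow> bool" where
  "CAP_excludes G s \<longleftrightarrow>
     (\<forall>k \<in> {real (min_degree G)..real (max_degree G)}.
        \<forall>l \<in> {real (min_edge_degree G)..real (max_edge_degree G)}.
          \<exists>x :: int. clique_adjacency G x s k l < 0)"

text \<open>Meaningful only for graphs with at least one edge.\<close>

definition generalised_CAP_bound :: "'a pair_pre_digraph \<Rightarrow> nat" where
  "generalised_CAP_bound G = (LEAST b. \<exists>s > 0. CAP_excludes G s \<and> b = s - 1)"

definition graph_complement :: "'a pair_pre_digraph \<Rightarrow> 'a pair_pre_digraph" where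
  "graph_complement G =
     \<lparr> pverts = pverts G,
       parcs = {(u, w). u \<in> pverts G \<and> w \<in> pverts G \<and> u \<noteq> w \<and> (u, w) \<notin> parcs G} \<rparr>"

text \<open>
  Matrices are indexed by initial segments of the naturals, so the rows and columns of an adjacency
  matrix are indexed through an enumeration of the vertices. Another enumeration gives a
  permutation-similar matrix, so the eigenvalues do not depend on the one that is chosen.
\<close>

definition vertex_enum :: "'a pair_pre_digraph \<Rightarrow> 'a list" where
  "vertex_enum G = (SOME vs. distinct vs \<and> set vs = pverts G)"

definition adjacency_matrix :: "'a pair_pre_digraph \<Rightarrow> real mat" where
  "adjacency_matrix G =
     mat (card (pverts G)) (card (pverts G))
       (\<lambda>(i, j). if (vertex_enum G ! i, vertex_enum G ! j) \<in> parcs G then 1 else 0)"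

definition max_eigenvalue :: "'a pair_pre_digraph \<Rightarrow> real" where
  "max_eigenvalue G = Max {c. eigenvalue (adjacency_matrix G) c}"

definition min_eigenvalue :: "'a pair_pre_digraph \<Rightarrow> real" where
  "min_eigenvalue G = Min {c. eigenvalue (adjacency_matrix G) c}"

text \<open>Meaningful only for non-complete graphs: for a complete graph it is \<open>0 / 0\<close>.\<close>

definition Haemers_bound :: "'a pair_pre_digraph \<Rightarrow> real" where
  "Haemers_bound G =
     (let v = real (card (pverts G));
          g1 = max_eigenvalue (graph_complement G);
          gv = min_eigenvalue (graph_complement G)
      in - v * g1 * gv / ((v - real (max_degree G) - 1)\<^sup>2 - g1 * gv))"

end

theory Submission
  imports Defs "Jordan_Normal_Form.Spectral_Radius"
begin

text \<open>
  A universal vertex forces \<open>\<Delta> = v - 1\<close>, so the Haemers bound collapses to \<open>v\<close> once the extreme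
  eigenvalues of the complement are known to be nonzero; they are, because the complement has an
  edge and its adjacency matrix is symmetric with trace zero. On the other side \<open>s = v\<close> already
  satisfies the exclusion condition with \<open>x = 0\<close>: an edge of edge-degree \<open>v - 2\<close> would have two
  universal endpoints, so \<open>\<lambda> < v - 2\<close> throughout. Hence the generalised CAP bound is at most \<open>v - 1\<close>.
\<close>

section \<open>Eigenvalues of real symmetric matrices\<close>

lemma trace_mult_comm:
  fixes A B :: "'a :: comm_semiring_0 mat"
  assumes "A \<in> carrier_mat n m" "B \<in> carrier_mat m n"
  shows "(\<Sum>i<n. (A * B) $$ (i, i)) = (\<Sum>j<m. (B * A) $$ (j, j))"
proof -
  have "(\<Sum>i<n. (A * B) $$ (i, i)) = (\<Sum>i<n. \<Sum>j<m. A $$ (i, j) * B $$ (j, i))"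
    using assms by (intro sum.cong refl) (auto simp: scalar_prod_def atLeast0LessThan)
  also have "\<dots> = (\<Sum>j<m. \<Sum>i<n. B $$ (j, i) * A $$ (i, j))"
    by (subst sum.swap) (simp add: mult.commute)
  also have "\<dots> = (\<Sum>j<m. (B * A) $$ (j, j))"
    using assms by (intro sum.cong refl) (auto simp: scalar_prod_def atLeast0LessThan)
  finally show ?thesis .
qed

text \<open>Cyclicity of the trace moves \<open>P\<close> to the right end of
  \<open>P * B * Q\<close>, where \<open>Q * P\<close> is the identity.\<close>

lemma trace_similar:
  fixes A B :: "'a :: comm_ring_1 mat"
  assumes A: "A \<in> carrier_mat n n" and sim: "similar_mat_wit A B P Q"
  shows "(\<Sum>i<n. A $$ (i, i)) = (\<Sum>i<n. B $$ (i, i))"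
proof -
  note w = similar_mat_witD2[OF A sim]
  have "(\<Sum>i<n. A $$ (i, i)) = (\<Sum>i<n. (P * (B * Q)) $$ (i, i))"
    using w by (simp add: assoc_mult_mat[of P n n B n Q n])
  also have "\<dots> = (\<Sum>i<n. (B * Q * P) $$ (i, i))"
    using w by (intro trace_mult_comm) auto
  also have "B * Q * P = B"
    using w by (simp add: assoc_mult_mat[of B n n Q n P n])
  finally show ?thesis .
qed

text \<open>Schur triangularisation: take for \<open>f\<close> the diagonal of an upper triangular
  \<open>B\<close> similar to \<open>A\<close>. Its entries are roots of the common characteristic
  polynomial, and similarity preserves both traces.\<close>

lemma complex_trace_square_eigenvalues:
  fixes A :: "complex mat"
  assumes A: "A \<in> carrier_mat n n"
  obtains f where "\<And>i. i < n \<Longrightarrow> eigenvalue A (f i)"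
    and "(\<Sum>i<n. A $$ (i, i)) = (\<Sum>i<n. f i)"
    and "(\<Sum>i<n. (A * A) $$ (i, i)) = (\<Sum>i<n. (f i)\<^sup>2)"
proof -
  obtain es where es: "char_poly A = (\<Prod>e\<leftarrow>es. [:- e, 1:])"
    using char_poly_factorized[OF A] by auto
  obtain B where B: "B \<in> carrier_mat n n" "upper_triangular B" "similar_mat A B"
    using schur_decomposition_exists[OF A es] by blast
  obtain P Q where sim: "similar_mat_wit A B P Q"
    using B(3) unfolding similar_mat_def by blast
  \<comment> \<open>The same \<open>P\<close> and \<open>Q\<close> conjugate the squares, so
    \<open>trace_similar\<close> applies to them too.\<close>
  have sq: "similar_mat_wit (A * A) (B * B) P Q"
    using similar_mat_wit_pow[OF sim, of 2] A B by (simp add: numeral_2_eq_2)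
  have diag: "(B * B) $$ (i, i) = (B $$ (i, i))\<^sup>2" if i: "i < n" for i
  proof -
    have "(B * B) $$ (i, i) = (\<Sum>j<n. B $$ (i, j) * B $$ (j, i))"
      using B(1) i by (auto simp: scalar_prod_def atLeast0LessThan)
    also have "\<dots> = (\<Sum>j\<in>{i}. B $$ (i, j) * B $$ (j, i))"
    \<comment> \<open>For \<open>j\<close> different from \<open>i\<close>, one of the two factors
      lies strictly below the diagonal of \<open>B\<close>.\<close>
    proof (intro sum.mono_neutral_right ballI)
      fix j assume "j \<in> {..<n} - {i}"
      then have "j < i \<or> i < j" "j < n" by auto
      then have "B $$ (i, j) = 0 \<or> B $$ (j, i) = 0"
        using upper_triangularD[OF B(2)] B(1) i by auto
      then show "B $$ (i, j) * B $$ (j, i) = 0" by auto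
    qed (use i in auto)
    finally show ?thesis by (simp add: power2_eq_square)
  qed
  show thesis
  proof (rule that)
    fix i assume "i < n"
    then have "B $$ (i, i) \<in> set (diag_mat B)"
      using B(1) by (auto simp: diag_mat_def)
    then show "eigenvalue A (B $$ (i, i))"
      using char_poly_upper_triangular[OF B(1,2)] char_poly_similar[OF B(3)]
      by (auto simp: eigenvalue_root_char_poly[OF A] poly_prod_list prod_list_zero_iff)
  next
    show "(\<Sum>i<n. A $$ (i, i)) = (\<Sum>i<n. B $$ (i, i))"
      by (rule trace_similar[OF A sim])
  next
    show "(\<Sum>i<n. (A * A) $$ (i, i)) = (\<Sum>i<n. (B $$ (i, i))\<^sup>2)"
      using trace_similar[OF _ sq, of n] A diag by simp
  qed
qed

text \<open>The Hermitian form \<open>S\<close> of the eigenvector \<open>v\<close> equals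
  \<open>e * N\<close>, where \<open>N\<close> is the squared norm of \<open>v\<close>. Both
  \<open>S\<close> and \<open>N\<close> are fixed by conjugation and \<open>N\<close> is nonzero, so
  \<open>e\<close> is its own conjugate.\<close>

lemma eigenvalue_real_symmetric:
  fixes A :: "real mat"
  assumes A: "A \<in> carrier_mat n n"
    and sym: "\<And>i j. i < n \<Longrightarrow> j < n \<Longrightarrow> A $$ (i, j) = A $$ (j, i)"
    and e: "eigenvalue (map_mat complex_of_real A) e"
  shows "e \<in> \<real>"
proof -
  obtain v where v: "v \<in> carrier_vec n" "v \<noteq> 0\<^sub>v n"
    and ev: "map_mat complex_of_real A *\<^sub>v v = e \<cdot>\<^sub>v v"
    using e A unfolding eigenvalue_def eigenvector_def by auto
  define N where "N = (\<Sum>i<n. v $ i * cnj (v $ i))"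
  define S where "S = (\<Sum>i<n. \<Sum>j<n. of_real (A $$ (i, j)) * v $ j * cnj (v $ i))"
  have comp: "(\<Sum>j<n. of_real (A $$ (i, j)) * v $ j) = e * v $ i" if "i < n" for i
    using arg_cong[OF ev, of "\<lambda>w. w $ i"] that A v
    by (auto simp: scalar_prod_def atLeast0LessThan)
  have "S = e * N"
    unfolding S_def N_def sum_distrib_left sum_distrib_right[symmetric]
    by (intro sum.cong refl) (simp add: comp mult.assoc)
  have "N = (\<Sum>i<n. of_real ((cmod (v $ i))\<^sup>2))"
    unfolding N_def by (simp add: complex_norm_square del: of_real_power)
  then have "cnj N = N" by simp
  have "N = v \<bullet>c v"
    using v by (simp add: N_def scalar_prod_def atLeast0LessThan)
  then have "N \<noteq> 0" using v by simp
  have "cnj S = (\<Sum>i<n. \<Sum>j<n. of_real (A $$ (i, j)) * cnj (v $ j) * v $ i)"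
    by (simp add: S_def)
  also have "\<dots> = (\<Sum>j<n. \<Sum>i<n. of_real (A $$ (i, j)) * cnj (v $ j) * v $ i)"
    by (rule sum.swap)
  also have "\<dots> = S"
    unfolding S_def using sym by (intro sum.cong refl) (simp add: mult_ac)
  finally have "cnj e * N = e * N"
    using \<open>S = e * N\<close> \<open>cnj N = N\<close> by simp
  with \<open>N \<noteq> 0\<close> show ?thesis by (simp add: Reals_cnj_iff)
qed

text \<open>The eigenvalues sum to the trace of \<open>A\<close>, and their squares to the trace of \<open>A * A\<close>, which
  is the sum of the squares of all entries.\<close>

lemma symmetric_trace_zero_eigenvalues:
  fixes A :: "real mat"
  assumes A: "A \<in> carrier_mat n n"
    and sym: "\<And>i j. i < n \<Longrightarrow> j < n \<Longrightarrow> A $$ (i, j) = A $$ (j, i)"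
    and tr: "(\<Sum>i<n. A $$ (i, i)) = 0"
    and nz: "p < n" "q < n" "A $$ (p, q) \<noteq> 0"
  shows "\<exists>c>0. eigenvalue A c" and "\<exists>c<0. eigenvalue A c"
proof -
  let ?C = "map_mat complex_of_real A"
  have C: "?C \<in> carrier_mat n n" using A by simp
  obtain f where f: "\<And>i. i < n \<Longrightarrow> eigenvalue ?C (f i)"
    and f1: "(\<Sum>i<n. ?C $$ (i, i)) = (\<Sum>i<n. f i)"
    and f2: "(\<Sum>i<n. (?C * ?C) $$ (i, i)) = (\<Sum>i<n. (f i)\<^sup>2)"
    using complex_trace_square_eigenvalues[OF C] by blast
  define g where "g i = Re (f i)" for i
  have fg: "f i = of_real (g i)" if "i < n" for i
    using eigenvalue_real_symmetric[OF A sym f[OF that]] by (simp add: g_def)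
  \<comment> \<open>The characteristic polynomial of \<open>?C\<close> is the image of that of
    \<open>A\<close>, so a real root of the former is a root of the latter.\<close>
  have ev: "eigenvalue A (g i)" if "i < n" for i
    using f[OF that] fg[OF that]
    by (simp add: eigenvalue_root_char_poly[OF C] eigenvalue_root_char_poly[OF A]
        of_real_hom.char_poly_hom[OF A])
  have "complex_of_real (\<Sum>i<n. g i) = (\<Sum>i<n. f i)" by (simp add: fg)
  also have "\<dots> = complex_of_real (\<Sum>i<n. A $$ (i, i))" using f1 A by simp
  finally have g1: "(\<Sum>i<n. g i) = 0" using tr by (simp only: of_real_eq_iff)
  have "complex_of_real (\<Sum>i<n. (g i)\<^sup>2) = (\<Sum>i<n. (f i)\<^sup>2)" by (simp add: fg)
  also have "\<dots> = (\<Sum>i<n. \<Sum>j<n. of_real ((A $$ (i, j))\<^sup>2))"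
    unfolding f2[symmetric] using A sym
    by (intro sum.cong refl) (auto simp: scalar_prod_def atLeast0LessThan power2_eq_square intro!: sum.cong)
  also have "\<dots> = complex_of_real (\<Sum>i<n. \<Sum>j<n. (A $$ (i, j))\<^sup>2)" by simp
  finally have g2: "(\<Sum>i<n. (g i)\<^sup>2) = (\<Sum>i<n. \<Sum>j<n. (A $$ (i, j))\<^sup>2)"
    by (simp only: of_real_eq_iff)
  \<comment> \<open>The nonzero entry makes the sum of squared eigenvalues positive, so some
    \<open>g k\<close> is nonzero.\<close>
  have "(A $$ (p, q))\<^sup>2 \<le> (\<Sum>j<n. (A $$ (p, j))\<^sup>2)"
    using nz by (intro member_le_sum) auto
  also have "\<dots> \<le> (\<Sum>i<n. \<Sum>j<n. (A $$ (i, j))\<^sup>2)"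
    using nz by (intro member_le_sum[of p _ "\<lambda>i. \<Sum>j<n. (A $$ (i, j))\<^sup>2"]) (auto intro: sum_nonneg)
  finally have "(\<Sum>i<n. (g i)\<^sup>2) \<noteq> 0" using nz g2 by (smt (verit) zero_less_power2)
  then obtain k where k: "k < n" "g k \<noteq> 0"
    by (metis (no_types, lifting) lessThan_iff sum.neutral zero_power2)
  \<comment> \<open>Terms of one sign summing to zero would all vanish, against
    \<open>g k \<noteq> 0\<close>; the negative case is the mirror image.\<close>
  have "\<exists>i<n. g i > 0"
  proof (rule ccontr)
    assume "\<not> (\<exists>i<n. g i > 0)"
    then have "\<forall>i\<in>{..<n}. g i \<le> 0" by (meson lessThan_iff not_less)
    then show False using g1 k sum_nonneg_eq_0_iff[of "{..<n}" "\<lambda>i. - g i"] by (auto simp: sum_negf)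
  qed
  then show "\<exists>c>0. eigenvalue A c" using ev by blast
  have "\<exists>i<n. g i < 0"
  proof (rule ccontr)
    assume "\<not> (\<exists>i<n. g i < 0)"
    then have "\<forall>i\<in>{..<n}. g i \<ge> 0" by (meson lessThan_iff not_less)
    then show False using g1 k sum_nonneg_eq_0_iff[of "{..<n}" g] by auto
  qed
  then show "\<exists>c<0. eigenvalue A c" using ev by blast
qed

section \<open>Graphs with a universal vertex\<close>

text \<open>Absence of loops gives trace zero, and the arc gives a nonzero entry.\<close>

lemma symmetric_parcs_eigenvalue_signs:
  fixes H :: "'a pair_pre_digraph"
  assumes fin: "finite (pverts H)"
    and sym: "\<And>a b. (a, b) \<in> parcs H \<Longrightarrow> (b, a) \<in> parcs H"
    and loopfree: "\<And>a. (a, a) \<notin> parcs H"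
    and arc: "(a, b) \<in> parcs H" "a \<in> pverts H" "b \<in> pverts H"
  shows "max_eigenvalue H > 0" and "min_eigenvalue H < 0"
proof -
  let ?n = "card (pverts H)" and ?A = "adjacency_matrix H" and ?vs = "vertex_enum H"
  have vs: "distinct ?vs \<and> set ?vs = pverts H"
    unfolding vertex_enum_def using finite_distinct_list[OF fin]
    by (metis (mono_tags, lifting) someI_ex)
  then have len: "length ?vs = ?n" by (metis distinct_card)
  obtain p q where pq: "p < ?n" "?vs ! p = a" "q < ?n" "?vs ! q = b"
    using vs arc len by (metis in_set_conv_nth)
  have A: "?A \<in> carrier_mat ?n ?n" by (simp add: adjacency_matrix_def)
  have ex: "\<exists>c>0. eigenvalue ?A c" "\<exists>c<0. eigenvalue ?A c"
    by (rule symmetric_trace_zero_eigenvalues[OF A _ _ pq(1,3)];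
        use pq arc sym loopfree in \<open>force simp: adjacency_matrix_def\<close>)+
  \<comment> \<open>\<open>Max\<close> and \<open>Min\<close> are meaningful only on a finite
    spectrum.\<close>
  have fin_ev: "finite {c. eigenvalue ?A c}"
    using card_finite_spectrum(1)[OF A] by (simp add: spectrum_def)
  show "max_eigenvalue H > 0"
    using ex(1) fin_ev unfolding max_eigenvalue_def by (subst Max_gr_iff) auto
  show "min_eigenvalue H < 0"
    using ex(2) fin_ev unfolding min_eigenvalue_def by (subst Min_less_iff) auto
qed

context pair_graph
begin

lemma out_degree_eq_card_neighbours:
  "out_degree (with_proj G) a = card {b. (a, b) \<in> parcs G}"
proof -
  have "out_arcs (with_proj G) a = Pair a ` {b. (a, b) \<in> parcs G}"
    by (auto simp: out_arcs_def)
  then show ?thesis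
    unfolding out_degree_def by (simp add: card_image inj_on_def)
qed

lemma neighbours_subset: "{b. (a, b) \<in> parcs G} \<subseteq> pverts G - {a}"
  using in_arcsD2 pair_no_loops by fastforce

lemma max_degree_universal:
  assumes u: "universal_vertex G u"
  shows "max_degree G = card (pverts G) - 1"
  unfolding max_degree_def
proof (rule Max_eqI)
  show "finite (out_degree (with_proj G) ` pverts G)"
    using pair_finite_verts by simp
next
  fix d assume "d \<in> out_degree (with_proj G) ` pverts G"
  then obtain a where a: "a \<in> pverts G" "d = card {b. (a, b) \<in> parcs G}"
    by (auto simp: out_degree_eq_card_neighbours)
  have "d \<le> card (pverts G - {a})"
    unfolding a(2) by (rule card_mono[OF _ neighbours_subset]) (simp add: pair_finite_verts)
  then show "d \<le> card (pverts G) - 1"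
    using a by simp
next
  have "{b. (u, b) \<in> parcs G} = pverts G - {u}"
    using u neighbours_subset[of u] by (auto simp: universal_vertex_def)
  then have "out_degree (with_proj G) u = card (pverts G) - 1"
    using u by (simp add: out_degree_eq_card_neighbours universal_vertex_def)
  then show "card (pverts G) - 1 \<in> out_degree (with_proj G) ` pverts G"
    using u by (metis imageI universal_vertex_def)
qed

text \<open>Common neighbours avoid both endpoints. If every other vertex were one, the adjacent
  vertices \<open>a\<close> and \<open>b\<close> would both be universal.\<close>

lemma edge_degree_less:
  assumes ab: "(a, b) \<in> parcs G" and nu: "\<not> universal_vertex G a \<or> \<not> universal_vertex G b"
  shows "edge_degree G (a, b) + 2 < card (pverts G)"
proof -
  let ?S = "{w \<in> pverts G. (a, w) \<in> parcs G \<and> (b, w) \<in> parcs G}"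
  have v: "a \<in> pverts G" "b \<in> pverts G" "a \<noteq> b"
    using in_arcsD1[OF ab] in_arcsD2[OF ab] pair_no_loops[OF ab] by auto
  have "?S \<subseteq> pverts G - {a, b}"
    using neighbours_subset[of a] neighbours_subset[of b] by auto
  moreover have "?S \<noteq> pverts G - {a, b}"
    using nu v ab arcs_symmetric[OF ab] by (auto simp: universal_vertex_def)
  ultimately have "card ?S < card (pverts G - {a, b})"
    by (intro psubset_card_mono) (auto simp: pair_finite_verts)
  moreover have "card (pverts G - {a, b}) = card (pverts G) - 2"
    using v by (simp add: card_Diff_subset)
  ultimately show ?thesis by (simp add: edge_degree_def)
qed

end

theorem theorem5p9:
  fixes G :: "'a pair_pre_digraph"
  assumes "pair_graph G"
    and "card (pverts G) > 1"
    and "\<exists>!u. universal_vertex G u"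
  shows "real (generalised_CAP_bound G) < Haemers_bound G"
proof -
  interpret pair_graph G by fact
  let ?v = "card (pverts G)" and ?H = "graph_complement G"
  obtain u where u: "universal_vertex G u"
    and uniq: "\<And>a. universal_vertex G a \<Longrightarrow> a = u"
    using assms(3) by blast
  obtain w where w: "w \<in> pverts G" "w \<noteq> u"
    using assms(2) by (metis One_nat_def card_le_Suc0_iff_eq not_less pair_finite_verts)
  have uw: "(u, w) \<in> parcs G" using u w by (simp add: universal_vertex_def)

  have "max_edge_degree G + 2 < ?v"
  proof -
    have "max_edge_degree G \<in> edge_degree G ` parcs G"
      unfolding max_edge_degree_def using uw pair_finite_arcs by (intro Max_in) auto
    then obtain a b where ab: "(a, b) \<in> parcs G" "max_edge_degree G = edge_degree G (a, b)"
      by auto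
    moreover have "a \<noteq> b" using pair_no_loops[OF ab(1)] by simp
    \<comment> \<open>Two distinct endpoints cannot both be \<open>u\<close>.\<close>
    ultimately show ?thesis using edge_degree_less uniq by metis
  qed
  \<comment> \<open>With \<open>x = 0\<close> only \<open>s * (s - 1) * (l - s + 2)\<close>
    survives. At \<open>s = ?v\<close> the last factor is negative, whatever \<open>k\<close> is, so
    one \<open>x\<close> serves the whole rectangle.\<close>
  then have "clique_adjacency G 0 ?v k l < 0" if "l \<le> real (max_edge_degree G)" for k l
    using that assms(2) by (auto simp: clique_adjacency_def mult_less_0_iff)
  then have "CAP_excludes G ?v"
    unfolding CAP_excludes_def by (meson atLeastAtMost_iff)
  then have "generalised_CAP_bound G \<le> ?v - 1"
    unfolding generalised_CAP_bound_def using assms(2) by (intro Least_le exI[of _ ?v]) auto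
  then have "generalised_CAP_bound G < ?v"
    using assms(2) by linarith

  moreover have "Haemers_bound G = real ?v"
  proof -
    have "\<not> universal_vertex G w" using uniq w by blast
    \<comment> \<open>The missing edge between \<open>w\<close> and \<open>x\<close> is an arc of
      the complement.\<close>
    then obtain x where x: "x \<in> pverts G" "x \<noteq> w" "(w, x) \<notin> parcs G"
      using w by (auto simp: universal_vertex_def)
    have "max_eigenvalue ?H > 0" "min_eigenvalue ?H < 0"
      by (rule symmetric_parcs_eigenvalue_signs[of _ w x];
          use x w pair_finite_verts arcs_symmetric in \<open>auto simp: graph_complement_def\<close>)+
    \<comment> \<open>The square in the denominator vanishes, and the nonzero product of the extreme
      eigenvalues cancels, leaving \<open>?v\<close>.\<close>
    moreover have "real ?v - real (max_degree G) - 1 = 0"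
      using max_degree_universal[OF u] assms(2) by simp
    ultimately show ?thesis
      by (simp add: Haemers_bound_def Let_def)
  qed
  ultimately show ?thesis by simp
qed

end
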